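(* For all integers $M\ge 2$ and $n\ge 1$, $$Y_1(M,n)\ \ge\ 2(M-1)^n-2(M-2)^n-n(M-2)^{n-1},$$ with the convention $0^0=1$.
   Context: A hypergraph $H$ on $[n]$ is a set of subsets (edges) of $[n]$; hypergraphs are assumed inclusion-free. For $w:[n]\to[M]$ and strictly increasing $f:[M]\to\mathbb{R}_{>0}$, let $fw(e)=\sum_{i\in e}f(w(i))$; $w$ is isolating for $H,f$ if exactly one edge of $H$ attains the minimum of $fw$ over $H$ (if $H$ has no edges, every $w$ is isolating). $Z_1(H,M,f)$ is the set of isolating $w\in[M]^n$ with $\min_x w(x)=1$, and $Y_1(M,n)=\min_{H,f}|Z_1(H,M,f)|$ over all hypergraphs $H$ on $[n]$ and all strictly increasing $f:[M]\to\mathbb{R}_{>0}$. *)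

theory Defs
  imports Complex_Main "HOL-Library.FuncSet"
begin

definition hypergraph :: "nat \<Rightarrow> nat set set \<Rightarrow> bool" where
  "hypergraph n H \<longleftrightarrow>
     H \<subseteq> Pow {1..n} \<and> (\<forall>e\<in>H. \<forall>e'\<in>H. e \<subseteq> e' \<longrightarrow> e = e')"

definition edge_weight :: "(nat \<Rightarrow> real) \<Rightarrow> (nat \<Rightarrow> nat) \<Rightarrow> nat set \<Rightarrow> real" where
  "edge_weight f w e = (\<Sum>i\<in>e. f (w i))"

definition isolating :: "nat set set \<Rightarrow> (nat \<Rightarrow> real) \<Rightarrow> (nat \<Rightarrow> nat) \<Rightarrow> bool" where
  "isolating H f w \<longleftrightarrow> H = {} \<or> (\<exists>!e. is_arg_min (edge_weight f w) (\<lambda>e. e \<in> H) e)"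

text \<open>A map on \<open>{1..M}\<close> is represented by a total function on \<open>nat\<close>; its values outside
  \<open>{1..M}\<close> are irrelevant to everything below.\<close>

definition admissible :: "nat \<Rightarrow> (nat \<Rightarrow> real) \<Rightarrow> bool" where
  "admissible M f \<longleftrightarrow> strict_mono_on {1..M} f \<and> (\<forall>k\<in>{1..M}. f k > 0)"

text \<open>Weight functions are extensional, so that they can be counted.\<close>

definition Z\<^sub>1 :: "nat \<Rightarrow> nat set set \<Rightarrow> nat \<Rightarrow> (nat \<Rightarrow> real) \<Rightarrow> (nat \<Rightarrow> nat) set" where
  "Z\<^sub>1 n H M f = {w \<in> {1..n} \<rightarrow>\<^sub>E {1..M}. isolating H f w \<and> Min (w ` {1..n}) = 1}"

definition Y\<^sub>1 :: "nat \<Rightarrow> nat \<Rightarrow> nat" where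
  "Y\<^sub>1 M n = Min {card (Z\<^sub>1 n H M f) | H f. hypergraph n H \<and> admissible M f}"

text \<open>The minimum is over a finite nonempty set, hence a genuine one.\<close>

lemma finite_Y\<^sub>1_set:
  "finite {card (Z\<^sub>1 n H M f) | H f. hypergraph n H \<and> admissible M f}"
proof (rule finite_subset)
  show "{card (Z\<^sub>1 n H M f) | H f. hypergraph n H \<and> admissible M f}
        \<subseteq> {..card ({1..n} \<rightarrow>\<^sub>E {1..M})}"
    by (auto simp: Z\<^sub>1_def intro!: card_mono finite_PiE)
qed simp

lemma nonempty_Y\<^sub>1_set:
  "{card (Z\<^sub>1 n H M f) | H f. hypergraph n H \<and> admissible M f} \<noteq> {}"
proof -
  have "hypergraph n {}" "admissible M real"
    by (auto simp: hypergraph_def admissible_def strict_mono_on_def)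
  then show ?thesis by blast
qed

end

theory Submission imports Defs begin

text \<open>
  Let \<open>v\<close> have values in \<open>{2..M}\<close> and let \<open>T\<close> be the set where it equals 2. Pick a nonempty
  \<open>S \<subseteq> T\<close>, lower \<open>v\<close> by one on \<open>S\<close>, and then lower a minimum edge \<open>e\<close> with \<open>e \<inter> T \<subseteq> S\<close> by one
  on \<open>e - S\<close>. If no other minimum edge contains \<open>e - S\<close>, the result isolates \<open>e\<close>, and it takes the
  value 1 exactly on \<open>S\<close>; hence \<open>v\<close>, \<open>S\<close> and \<open>e\<close> can be read off from it. The right-hand side of
  the bound counts the \<open>v\<close> with \<open>|T| = 1\<close> once and those with \<open>|T| \<ge> 2\<close> twice, so it would suffice
  that \<open>v\<close> yields \<open>min |T| 2\<close> results. This fails only if \<open>|T| \<ge> 2\<close>, \<open>T \<subseteq> e\<close> and lowering \<open>v\<close> at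
  any single \<open>x \<in> T\<close> isolates \<open>e\<close>; one result is then missing. In that case, for each of the at
  least two \<open>x \<in> T\<close>, lower \<open>v\<close> at \<open>x\<close> and raise it on \<open>e - {x}\<close> as long as \<open>e\<close> stays isolated. The
  final weights are distinct for distinct pairs \<open>(v, x)\<close>, and such a weight is either not one of the
  results above or it is the result of a \<open>v'\<close> with \<open>|T'| = 1\<close> which has a tie and therefore a
  second result. Charging each final weight one half makes up for what is missing.
\<close>

section \<open>Lowering weights and extremal members of finite families\<close>

definition low :: "(nat \<Rightarrow> nat) \<Rightarrow> nat set \<Rightarrow> nat \<Rightarrow> nat" where
  "low w A = (\<lambda>i. if i \<in> A then w i - 1 else w i)"

lemma low_low: "A \<inter> B = {} \<Longrightarrow> low (low w A) B = low w (A \<union> B)"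
  by (auto simp: low_def fun_eq_iff)

lemma card_ge_2: "\<lbrakk>finite A; a \<in> A; b \<in> A; a \<noteq> b\<rbrakk> \<Longrightarrow> card A \<ge> 2"
  using card_mono[of A "{a, b}"] by simp

lemma maximal_image:
  fixes g :: "'a \<Rightarrow> 'b set"
  assumes "finite A" "a \<in> A"
  shows "\<exists>b\<in>A. g a \<subseteq> g b \<and> (\<forall>c\<in>A. g b \<subseteq> g c \<longrightarrow> g c = g b)"
proof -
  have "finite (g ` A)" "g a \<in> g ` A" using assms by auto
  from finite_has_maximal2[OF this] obtain m
    where m: "m \<in> g ` A" "g a \<subseteq> m" "\<forall>m'\<in>g ` A. m \<subseteq> m' \<longrightarrow> m = m'" by blast
  then obtain b where "b \<in> A" "m = g b" by blast
  then show ?thesis using m by (intro bexI[of _ b]) auto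
qed

lemma minimal_image:
  fixes g :: "'a \<Rightarrow> 'b set"
  assumes "finite A" "a \<in> A"
  shows "\<exists>b\<in>A. g b \<subseteq> g a \<and> (\<forall>c\<in>A. g c \<subseteq> g b \<longrightarrow> g c = g b)"
proof -
  have "finite (g ` A)" "g a \<in> g ` A" using assms by auto
  from finite_has_minimal2[OF this] obtain m
    where m: "m \<in> g ` A" "m \<subseteq> g a" "\<forall>m'\<in>g ` A. m' \<subseteq> m \<longrightarrow> m = m'" by blast
  then obtain b where "b \<in> A" "m = g b" by blast
  then show ?thesis using m by (intro bexI[of _ b]) auto
qed

section \<open>Hypergraphs with an edge and their minimum edges\<close>

locale isolation =
  fixes n M :: nat and H :: "nat set set" and f :: "nat \<Rightarrow> real"
  assumes hypergraph: "hypergraph n H" and nonempty: "H \<noteq> {}" and admissible: "admissible M f"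
begin

abbreviation cost :: "(nat \<Rightarrow> nat) \<Rightarrow> nat set \<Rightarrow> real" where
  "cost \<equiv> edge_weight f"

definition mins :: "(nat \<Rightarrow> nat) \<Rightarrow> nat set set" where
  "mins w = {e \<in> H. \<forall>e'\<in>H. cost w e \<le> cost w e'}"

definition weights :: "(nat \<Rightarrow> nat) set" where
  "weights = {1..n} \<rightarrow>\<^sub>E {1..M}"

definition lifted :: "(nat \<Rightarrow> nat) set" where
  "lifted = {1..n} \<rightarrow>\<^sub>E {2..M}"

definition twos :: "(nat \<Rightarrow> nat) \<Rightarrow> nat set" where
  "twos v = {i \<in> {1..n}. v i = 2}"

lemma edge_subset: "e \<in> H \<Longrightarrow> e \<subseteq> {1..n}"
  using hypergraph by (auto simp: hypergraph_def)

lemma edge_eqI: "\<lbrakk>e \<in> H; e' \<in> H; e \<subseteq> e'\<rbrakk> \<Longrightarrow> e = e'"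
  using hypergraph by (auto simp: hypergraph_def)

lemma finite_H: "finite H"
  using hypergraph by (auto simp: hypergraph_def intro: finite_subset)

lemma finite_edge: "e \<in> H \<Longrightarrow> finite e"
  using edge_subset finite_subset by blast

lemma mins_subset: "mins w \<subseteq> H"
  by (auto simp: mins_def)

lemma mins_H: "e \<in> mins w \<Longrightarrow> e \<in> H"
  by (auto simp: mins_def)

lemma finite_mins: "finite (mins w)"
  using finite_H mins_subset finite_subset by blast

lemma mins_nonempty: "mins w \<noteq> {}"
proof -
  obtain e where "e \<in> H" "\<forall>e'\<in>H. cost w e \<le> cost w e'"
    using ex_min_if_finite[of "cost w ` H"] finite_H nonempty by (fastforce simp: not_less)
  then show ?thesis by (auto simp: mins_def)
qed

lemma mins_antichain: "\<lbrakk>e \<in> mins w; e' \<in> mins w; e \<subseteq> e'\<rbrakk> \<Longrightarrow> e = e'"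
  using edge_eqI mins_H by blast

lemma isolating_iff: "isolating H f w \<longleftrightarrow> (\<exists>e. mins w = {e})"
proof -
  have "is_arg_min (cost w) (\<lambda>e. e \<in> H) e \<longleftrightarrow> e \<in> mins w" for e
    by (auto simp: is_arg_min_def mins_def not_less)
  then show ?thesis
    using nonempty by (auto simp: isolating_def)
qed

lemma f_less: "\<lbrakk>1 \<le> a; a < b; b \<le> M\<rbrakk> \<Longrightarrow> f a < f b"
  using admissible by (auto simp: admissible_def strict_mono_on_def)

lemma f_pos: "\<lbrakk>1 \<le> a; a \<le> M\<rbrakk> \<Longrightarrow> f a > 0"
  using admissible by (auto simp: admissible_def)

section \<open>Effect of lowering on the minimum edges\<close>

definition drop_weight :: "(nat \<Rightarrow> nat) \<Rightarrow> nat set \<Rightarrow> real" where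
  "drop_weight z D = (\<Sum>i\<in>D. f (z i) - f (z i - 1))"

lemma cost_low:
  assumes "finite e"
  shows "cost (low z D) e = cost z e - drop_weight z (D \<inter> e)"
proof -
  have "cost (low z D) e = (\<Sum>i\<in>e. f (z i) - (if i \<in> D then f (z i) - f (z i - 1) else 0))"
    unfolding edge_weight_def low_def by (rule sum.cong) auto
  also have "\<dots> = cost z e - (\<Sum>i\<in>e. if i \<in> D then f (z i) - f (z i - 1) else 0)"
    by (simp add: edge_weight_def sum_subtractf)
  also have "(\<Sum>i\<in>e. if i \<in> D then f (z i) - f (z i - 1) else 0) = drop_weight z (D \<inter> e)"
    unfolding drop_weight_def using assms by (subst Int_commute) (rule sum.inter_restrict[symmetric])
  finally show ?thesis .
qed

text \<open>The bounds keep both \<open>z i\<close> and \<open>z i - 1\<close> in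
  \<open>{1..M}\<close>, where \<open>f\<close> is strictly increasing, so every drop is
  positive.\<close>

definition lowerable :: "(nat \<Rightarrow> nat) \<Rightarrow> nat set \<Rightarrow> bool" where
  "lowerable z D \<longleftrightarrow> finite D \<and> (\<forall>i\<in>D. 2 \<le> z i \<and> z i \<le> M)"

lemma drop_weight_pos: "\<lbrakk>lowerable z D; D \<noteq> {}\<rbrakk> \<Longrightarrow> drop_weight z D > 0"
  unfolding drop_weight_def lowerable_def by (rule sum_pos) (auto intro!: f_less)

lemma lowerable_subset: "\<lbrakk>lowerable z D; E \<subseteq> D\<rbrakk> \<Longrightarrow> lowerable z E"
  by (auto simp: lowerable_def intro: finite_subset)

lemma drop_weight_less:
  assumes "lowerable z D" "E \<subset> D"
  shows "drop_weight z E < drop_weight z D"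
proof -
  have "drop_weight z D = drop_weight z (D - E) + drop_weight z E"
    unfolding drop_weight_def using assms by (intro sum.subset_diff) (auto simp: lowerable_def)
  moreover have "drop_weight z (D - E) > 0"
    using assms by (intro drop_weight_pos lowerable_subset[OF assms(1)]) auto
  ultimately show ?thesis by simp
qed

text \<open>An edge gets cheaper by the drop on its intersection with \<open>D\<close>, which is
  strictly less than the drop on all of \<open>D\<close> unless the edge contains \<open>D\<close>.
  Since the minimum edge \<open>e\<close> contains \<open>D\<close>, the minimum sinks by the full
  drop, and only former minimum edges containing \<open>D\<close> keep up.\<close>

lemma mins_low_inside:
  assumes "lowerable z D" "e \<in> mins z" "D \<subseteq> e"
  shows "mins (low z D) = {e' \<in> mins z. D \<subseteq> e'}"
proof -
  have le: "drop_weight z (D \<inter> e') \<le> drop_weight z D" for e'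
    using drop_weight_less[OF assms(1), of "D \<inter> e'"]
    by (cases "D \<inter> e' = D") (simp_all add: psubset_eq less_imp_le)
  have less: "drop_weight z (D \<inter> e') < drop_weight z D" if "\<not> D \<subseteq> e'" for e'
    using that by (intro drop_weight_less[OF assms(1)]) auto
  have full: "cost (low z D) e' = cost z e' - drop_weight z D" if "e' \<in> H" "D \<subseteq> e'" for e'
    using cost_low[of e' z D] that finite_edge by (simp add: Int_absorb2)
  have part: "cost (low z D) e' = cost z e' - drop_weight z (D \<inter> e')" if "e' \<in> H" for e'
    using cost_low[of e' z D] that finite_edge by simp
  have e: "e \<in> H" "cost z e \<le> cost z e'" if "e' \<in> H" for e'
    using assms(2) that by (auto simp: mins_def)
  have eH: "e \<in> H" using assms(2) by (rule mins_H)
  show ?thesis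
  proof (intro equalityI subsetI)
    fix a assume "a \<in> mins (low z D)"
    then have a: "a \<in> H" "cost (low z D) a \<le> cost (low z D) e"
      using eH by (auto simp: mins_def)
    have sub: "D \<subseteq> a"
      using less[of a] part[OF a(1)] full[OF eH assms(3)] a e(2)[OF a(1)] by (cases "D \<subseteq> a") auto
    then have "cost z a \<le> cost z e"
      using a full eH assms(3) by simp
    then have "a \<in> mins z"
      using a(1) e(2) by (force simp: mins_def)
    with sub show "a \<in> {e' \<in> mins z. D \<subseteq> e'}" by simp
  next
    fix a assume "a \<in> {e' \<in> mins z. D \<subseteq> e'}"
    then have a: "a \<in> H" "D \<subseteq> a" "\<And>b. b \<in> H \<Longrightarrow> cost z a \<le> cost z b"
      by (auto simp: mins_def)
    have "cost (low z D) a \<le> cost (low z D) b" if "b \<in> H" for b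
      using full[OF a(1,2)] part[OF that] le[of b] a(3)[OF that] by linarith
    then show "a \<in> mins (low z D)"
      using a(1) by (simp add: mins_def)
  qed
qed

text \<open>Read backwards, from the lowered weight to \<open>z\<close>: raising on \<open>D\<close>
  makes the edges meeting \<open>D\<close> strictly dearer and leaves the others alone. As
  \<open>e\<close> is among the others, the minimum value is unchanged.\<close>

lemma mins_low_outside:
  assumes "lowerable z D" "e \<in> mins (low z D)" "D \<inter> e = {}"
  shows "mins z = {e' \<in> mins (low z D). D \<inter> e' = {}}"
proof -
  have ge: "drop_weight z (D \<inter> e') \<ge> 0" for e'
    using drop_weight_pos[OF lowerable_subset[OF assms(1)], of "D \<inter> e'"]
    by (cases "D \<inter> e' = {}") (auto simp: drop_weight_def)
  have pos: "drop_weight z (D \<inter> e') > 0" if "D \<inter> e' \<noteq> {}" for e'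
    using that by (intro drop_weight_pos lowerable_subset[OF assms(1)]) auto
  have zero: "cost (low z D) e' = cost z e'" if "e' \<in> H" "D \<inter> e' = {}" for e'
    using cost_low[of e' z D] that finite_edge by (simp add: drop_weight_def)
  have part: "cost (low z D) e' = cost z e' - drop_weight z (D \<inter> e')" if "e' \<in> H" for e'
    using cost_low[of e' z D] that finite_edge by simp
  have e: "cost (low z D) e \<le> cost (low z D) e'" if "e' \<in> H" for e'
    using assms(2) that by (auto simp: mins_def)
  have eH: "e \<in> H" using assms(2) by (rule mins_H)
  show ?thesis
  proof (intro equalityI subsetI)
    fix a assume "a \<in> mins z"
    then have a: "a \<in> H" "cost z a \<le> cost z e"
      using eH by (auto simp: mins_def)
    have sub: "D \<inter> a = {}"
      using pos[of a] part[OF a(1)] zero[OF eH assms(3)] a e[OF a(1)] by (cases "D \<inter> a = {}") auto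
    then have "cost (low z D) a \<le> cost (low z D) e"
      using a zero eH assms(3) by simp
    then have "a \<in> mins (low z D)"
      using a(1) e by (force simp: mins_def)
    with sub show "a \<in> {e' \<in> mins (low z D). D \<inter> e' = {}}" by simp
  next
    fix a assume "a \<in> {e' \<in> mins (low z D). D \<inter> e' = {}}"
    then have a: "a \<in> H" "D \<inter> a = {}" "\<And>b. b \<in> H \<Longrightarrow> cost (low z D) a \<le> cost (low z D) b"
      by (auto simp: mins_def)
    have "cost z a \<le> cost z b" if "b \<in> H" for b
      using zero[OF a(1,2)] part[OF that] ge[of b] a(3)[OF that] by linarith
    then show "a \<in> mins z"
      using a(1) by (simp add: mins_def)
  qed
qed

text \<open>Exchanging \<open>x\<close> for the heavier \<open>t\<close> in \<open>e\<close> raises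
  the cost, and the remaining elements of \<open>e'\<close> only add to it because \<open>f\<close>
  is positive. If \<open>x\<close> is not in \<open>e\<close>, inserting it first also only
  adds.\<close>

lemma cost_exchange:
  assumes "z \<in> weights" "e \<in> H" "e' \<in> H" "e - {x} \<subseteq> e'" "x \<in> {1..n}" "t \<in> e' - e" "z x < z t"
  shows "cost z e < cost z e'"
proof -
  have rng: "1 \<le> z i \<and> z i \<le> M" if "i \<in> {1..n}" for i
    using assms(1) that by (auto simp: weights_def PiE_iff)
  have pos: "f (z i) > 0" if "i \<in> {1..n}" for i
    using rng[OF that] f_pos by blast
  have fin: "finite e" "finite e'" using assms finite_edge by auto
  have t: "t \<in> {1..n}" using assms(3,6) edge_subset by blast
  have "cost z e \<le> cost z (insert x (e - {x}))"
    unfolding edge_weight_def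
  proof (rule sum_mono2)
    show "0 \<le> f (z b)" if "b \<in> insert x (e - {x}) - e" for b
      using that pos[OF assms(5)] by auto
  qed (use fin in auto)
  also have "\<dots> = f (z x) + cost z (e - {x})"
    using fin by (simp add: edge_weight_def del: insert_Diff_single)
  also have "\<dots> < f (z t) + cost z (e - {x})"
    using rng[OF assms(5)] rng[OF t] assms(7) f_less by simp
  also have "\<dots> = cost z (insert t (e - {x}))"
    using fin assms(6) by (simp add: edge_weight_def)
  also have "\<dots> \<le> cost z e'"
    unfolding edge_weight_def
  proof (rule sum_mono2)
    show "0 \<le> f (z b)" if "b \<in> e' - insert t (e - {x})" for b
      using that pos[of b] edge_subset[OF assms(3)] by auto
  qed (use fin assms in auto)
  finally show ?thesis .
qed

section \<open>Lifted weights and the results obtained from them\<close>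

lemma lifted_range: "\<lbrakk>v \<in> lifted; i \<in> {1..n}\<rbrakk> \<Longrightarrow> 2 \<le> v i \<and> v i \<le> M"
  by (auto simp: lifted_def PiE_iff)

lemma twos_subset: "twos v \<subseteq> {1..n}"
  by (auto simp: twos_def)

lemma finite_twos: "finite (twos v)"
  using twos_subset finite_subset by blast

lemma twos_D: "i \<in> twos v \<Longrightarrow> v i = 2"
  by (auto simp: twos_def)

lemma finite_weights: "finite weights"
  by (auto simp: weights_def intro: finite_PiE)

lemma finite_lifted: "finite lifted"
  by (auto simp: lifted_def intro: finite_PiE)

lemma low_in_weights:
  assumes "v \<in> lifted" "A \<subseteq> {1..n}"
  shows "low v A \<in> weights"
proof -
  have "v i \<in> {2..M}" if "i \<in> {1..n}" for i
    using lifted_range[OF assms(1) that] by simp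
  moreover have "v i = undefined" if "i \<notin> {1..n}" for i
    using assms(1) that by (auto simp: lifted_def PiE_iff extensional_def)
  ultimately show ?thesis
    using assms(2) by (fastforce simp: weights_def low_def PiE_iff extensional_def)
qed

lemma lowerable_low:
  assumes "v \<in> lifted" "B \<subseteq> {1..n}" "A \<inter> B = {}"
  shows "lowerable (low v A) B"
  using assms lifted_range[OF assms(1)] finite_subset[OF assms(2)]
  by (auto simp: lowerable_def low_def)

text \<open>The clause \<open>e \<inter> twos v \<subseteq> S\<close> keeps the second lowering, on
  \<open>e - S\<close>, away from the remaining twos, so that no further ones arise.\<close>

definition valid :: "(nat \<Rightarrow> nat) \<Rightarrow> nat set \<Rightarrow> nat set \<Rightarrow> bool" where
  "valid v S e \<longleftrightarrow> S \<noteq> {} \<and> S \<subseteq> twos v \<and> e \<in> mins (low v S) \<and> e \<inter> twos v \<subseteq> S \<and>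
     (\<forall>e'\<in>mins (low v S). e - S \<subseteq> e' \<longrightarrow> e' = e)"

definition outputs :: "(nat \<Rightarrow> nat) \<Rightarrow> (nat \<Rightarrow> nat) set" where
  "outputs v = {low v (S \<union> e) | S e. valid v S e}"

lemma valid_subset:
  assumes "valid v S e"
  shows "S \<subseteq> {1..n}" "e \<subseteq> {1..n}" "S \<union> e \<subseteq> {1..n}"
  using assms twos_subset[of v] edge_subset[of e] mins_H[of e]
  unfolding valid_def by blast+

text \<open>The lowering is done in two stages, first on \<open>S\<close>, then on
  \<open>e - S\<close>. The second stage stays inside the minimum edge \<open>e\<close>, so it
  retains exactly the minimum edges containing \<open>e - S\<close>.\<close>

lemma valid_mins:
  assumes "v \<in> lifted" "valid v S e"
  shows "mins (low v (S \<union> e)) = {e}"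
proof -
  have "low v (S \<union> e) = low (low v S) (e - S)"
    by (subst low_low) (auto simp: Un_Diff_cancel)
  moreover have "lowerable (low v S) (e - S)"
    using assms valid_subset[OF assms(2)] by (intro lowerable_low) auto
  ultimately have "mins (low v (S \<union> e)) = {e' \<in> mins (low v S). e - S \<subseteq> e'}"
    using assms(2) mins_low_inside[of "low v S" "e - S" e] by (auto simp: valid_def)
  then show ?thesis
    using assms(2) by (auto simp: valid_def)
qed

lemma valid_ones:
  assumes "v \<in> lifted" "valid v S e" "i \<in> {1..n}"
  shows "low v (S \<union> e) i = 1 \<longleftrightarrow> i \<in> S"
  using assms lifted_range[OF assms(1,3)] by (auto simp: valid_def low_def twos_def)

text \<open>The result shows \<open>e\<close> as its only minimum edge and \<open>S\<close> as its
  set of ones. Adding one back on \<open>S \<union> e\<close> recovers \<open>v\<close>; the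
  truncated subtraction loses nothing since lifted values are at least 2.\<close>

lemma valid_unique:
  assumes "v \<in> lifted" "v' \<in> lifted" "valid v S e" "valid v' S' e'"
    and eq: "low v (S \<union> e) = low v' (S' \<union> e')"
  shows "v = v' \<and> S = S' \<and> e = e'"
proof -
  have e: "e = e'"
    using valid_mins[OF assms(1,3)] valid_mins[OF assms(2,4)] eq by simp
  have S: "S = S'"
  proof (rule set_eqI)
    fix i
    show "i \<in> S \<longleftrightarrow> i \<in> S'"
      using valid_ones[OF assms(1,3), of i] valid_ones[OF assms(2,4), of i] eq
        valid_subset(1)[OF assms(3)] valid_subset(1)[OF assms(4)] by (cases "i \<in> {1..n}") auto
  qed
  have "v i = v' i" for i
  proof (cases "i \<in> S \<union> e")
    case True
    then have "i \<in> {1..n}" using valid_subset(3)[OF assms(3)] by blast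
    then have "v i \<ge> 2" "v' i \<ge> 2" using lifted_range assms(1,2) by auto
    moreover have "v i - 1 = v' i - 1"
      using fun_cong[OF eq, of i] True e S by (simp add: low_def)
    ultimately show ?thesis by simp
  next
    case False
    then show ?thesis using fun_cong[OF eq, of i] e S by (simp add: low_def)
  qed
  with e S show ?thesis by blast
qed

lemma outputs_disjoint: "\<lbrakk>v \<in> lifted; v' \<in> lifted; v \<noteq> v'\<rbrakk> \<Longrightarrow> outputs v \<inter> outputs v' = {}"
  using valid_unique by (fastforce simp: outputs_def)

lemma in_Z1I:
  assumes "w \<in> weights" "mins w = {e}" "i \<in> {1..n}" "w i = 1"
  shows "w \<in> Z\<^sub>1 n H M f"
proof -
  have "w j \<ge> 1" if "j \<in> {1..n}" for j
    using assms(1) that by (auto simp: weights_def PiE_iff)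
  then have "Min (w ` {1..n}) = 1"
    using assms(3,4) by (intro Min_eqI) (auto intro: image_eqI[of _ w i])
  then show ?thesis
    using assms(1,2) isolating_iff by (auto simp: Z\<^sub>1_def weights_def)
qed

lemma outputs_subset: "v \<in> lifted \<Longrightarrow> outputs v \<subseteq> Z\<^sub>1 n H M f"
proof
  fix w assume v: "v \<in> lifted" and "w \<in> outputs v"
  then obtain S e where *: "valid v S e" "w = low v (S \<union> e)"
    by (auto simp: outputs_def)
  then obtain i where i: "i \<in> S" by (auto simp: valid_def)
  have "i \<in> {1..n}" using i valid_subset(1)[OF *(1)] by blast
  then show "w \<in> Z\<^sub>1 n H M f"
    unfolding *(2) using i valid_ones[OF v *(1)]
    by (intro in_Z1I[OF low_in_weights[OF v valid_subset(3)[OF *(1)]] valid_mins[OF v *(1)]]) auto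
qed

lemma finite_Z1: "finite (Z\<^sub>1 n H M f)"
  by (rule finite_subset[OF _ finite_weights]) (auto simp: Z\<^sub>1_def weights_def)

lemma finite_outputs: "v \<in> lifted \<Longrightarrow> finite (outputs v)"
  using outputs_subset finite_Z1 finite_subset by blast

lemma two_outputs:
  assumes "v \<in> lifted" "valid v S e" "valid v S' e'" "S \<noteq> S' \<or> e \<noteq> e'"
  shows "card (outputs v) \<ge> 2"
proof (rule card_ge_2)
  show "low v (S \<union> e) \<in> outputs v" "low v (S' \<union> e') \<in> outputs v"
    using assms by (auto simp: outputs_def)
  show "low v (S \<union> e) \<noteq> low v (S' \<union> e')"
    using valid_unique[OF assms(1,1,2,3)] assms(4) by blast
qed (rule finite_outputs[OF assms(1)])

section \<open>How many results a lifted weight yields\<close>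

lemma valid_above_single:
  assumes "v \<in> lifted" "twos v = {x}" "e \<in> mins (low v {x})"
  shows "\<exists>e'. valid v {x} e' \<and> e - {x} \<subseteq> e'"
proof -
  \<comment> \<open>Take \<open>e'\<close> maximal off \<open>x\<close>. A minimum edge containing
    \<open>e' - {x}\<close> then differs from \<open>e'\<close> at most at \<open>x\<close>, so the
    two are comparable and hence equal.\<close>
  obtain e' where e': "e' \<in> mins (low v {x})" "e - {x} \<subseteq> e' - {x}"
    "\<forall>e''\<in>mins (low v {x}). e' - {x} \<subseteq> e'' - {x} \<longrightarrow> e'' - {x} = e' - {x}"
    using maximal_image[OF finite_mins assms(3), of "\<lambda>a. a - {x}"] by blast
  have "e'' = e'" if "e'' \<in> mins (low v {x})" "e' - {x} \<subseteq> e''" for e''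
  proof -
    have "e'' - {x} = e' - {x}" using e'(3) that by blast
    then have "e' \<subseteq> e'' \<or> e'' \<subseteq> e'" by blast
    then show ?thesis using mins_antichain that(1) e'(1) by blast
  qed
  then show ?thesis
    using assms(2) e' by (auto simp: valid_def)
qed

definition bad :: "(nat \<Rightarrow> nat) \<Rightarrow> nat set \<Rightarrow> bool" where
  "bad v e \<longleftrightarrow> twos v \<subseteq> e \<and> (\<forall>x\<in>twos v. mins (low v {x}) = {e})"

text \<open>Going from \<open>low v (twos v)\<close> to \<open>low v S\<close> undoes a lowering on
  \<open>twos v - S\<close>, which \<open>e\<close> avoids. All such \<open>S\<close> can thus be
  studied through the one family \<open>mins (low v (twos v))\<close>.\<close>

lemma mins_low_part:
  assumes "v \<in> lifted" "e \<in> mins (low v (twos v))" "e \<inter> twos v \<subseteq> S" "S \<subseteq> twos v"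
  shows "mins (low v S) = {e' \<in> mins (low v (twos v)). e' \<inter> twos v \<subseteq> S}"
proof -
  have eq: "low (low v S) (twos v - S) = low v (twos v)"
    using low_low[of S "twos v - S" v] assms(4) by (simp add: Un_absorb1)
  have "lowerable (low v S) (twos v - S)"
    using assms(1) twos_subset[of v] by (intro lowerable_low) auto
  then have "mins (low v S) = {e' \<in> mins (low v (twos v)). (twos v - S) \<inter> e' = {}}"
    using mins_low_outside[of "low v S" "twos v - S" e] assms(2,3) unfolding eq by blast
  then show ?thesis by blast
qed

text \<open>By minimality a rival edge has the same trace on \<open>twos v\<close> as
  \<open>e\<close>. If it also contains the rest of \<open>e\<close>, it contains \<open>e\<close>,
  and the antichain property applies.\<close>

lemma valid_minimal:
  assumes "v \<in> lifted" "e \<in> mins (low v (twos v))" "e \<inter> twos v \<noteq> {}"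
    and minimal: "\<And>e'. \<lbrakk>e' \<in> mins (low v (twos v)); e' \<inter> twos v \<subseteq> e \<inter> twos v\<rbrakk>
           \<Longrightarrow> e' \<inter> twos v = e \<inter> twos v"
  shows "valid v (e \<inter> twos v) e"
proof -
  have m: "mins (low v (e \<inter> twos v)) =
      {e' \<in> mins (low v (twos v)). e' \<inter> twos v \<subseteq> e \<inter> twos v}"
    by (rule mins_low_part[OF assms(1,2)]) auto
  have "e' = e" if "e' \<in> mins (low v (e \<inter> twos v))" "e - e \<inter> twos v \<subseteq> e'" for e'
  proof -
    have "e' \<inter> twos v = e \<inter> twos v" using minimal that(1) unfolding m by blast
    then have "e \<subseteq> e'" using that(2) by blast
    then show ?thesis using mins_antichain[of e "low v (twos v)" e'] that(1) assms(2) unfolding m by blast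
  qed
  then show ?thesis
    unfolding valid_def using assms(2,3) m by blast
qed

lemma valid_of_second_min:
  assumes v: "v \<in> lifted" and x: "x \<in> twos v"
    and only: "mins (low v (twos v)) = {e}" and sub: "twos v \<subseteq> e"
    and e': "e' \<in> mins (low v {x})" "e' \<noteq> e"
  shows "\<exists>S e''. valid v S e'' \<and> S \<noteq> twos v"
proof -
  \<comment> \<open>Lowering on the rest of \<open>e' \<inter> twos v\<close> keeps \<open>e'\<close> minimal. It cannot exhaust \<open>twos v\<close>, since
    \<open>e'\<close> would then also be minimal once \<open>v\<close> is lowered on all of \<open>twos v\<close>.\<close>
  define S where "S = insert x (e' \<inter> twos v)"
  have low_x: "mins (low v (insert x D)) = {e'' \<in> mins (low v {x}). D - {x} \<subseteq> e''}"
    if "D \<subseteq> e'" "D \<subseteq> twos v" for D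
  proof -
    have "low v (insert x D) = low (low v {x}) (D - {x})"
      using low_low[of "{x}" "D - {x}" v] by simp
    moreover have "lowerable (low v {x}) (D - {x})"
      using that twos_subset[of v] by (intro lowerable_low[OF v]) auto
    ultimately show ?thesis
      using mins_low_inside[of "low v {x}" "D - {x}" e'] e'(1) that by auto
  qed
  have S_mins: "mins (low v S) = {e'' \<in> mins (low v {x}). e' \<inter> twos v - {x} \<subseteq> e''}"
    unfolding S_def using low_x[of "e' \<inter> twos v"] by blast
  have S_sub: "S \<subseteq> twos v" using x by (auto simp: S_def)
  have S_ne: "S \<noteq> twos v"
  proof
    assume "S = twos v"
    then have "e' \<in> mins (low v (twos v))" using S_mins e'(1) by blast
    then show False using only e'(2) by simp
  qed
  \<comment> \<open>The edge for \<open>S\<close> is chosen in \<open>?E\<close> with its part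
    outside \<open>twos v\<close> maximal, so that a rival in \<open>?E\<close> agrees with it
    there.\<close>
  let ?E = "{e'' \<in> mins (low v S). e'' \<inter> twos v \<subseteq> S}"
  have "finite ?E" "e' \<in> ?E"
    using finite_mins S_mins e'(1) by (auto simp: S_def)
  then obtain a where a: "a \<in> ?E"
    and max: "\<forall>c\<in>?E. a - twos v \<subseteq> c - twos v \<longrightarrow> c - twos v = a - twos v"
    using maximal_image[of ?E e' "\<lambda>a. a - twos v"] by blast
  then have a: "a \<in> mins (low v S)" "a \<inter> twos v \<subseteq> S" by auto
  have "b = a" if b: "b \<in> mins (low v S)" "a - S \<subseteq> b" for b
  proof (cases "b \<inter> twos v \<subseteq> S")
    case True
    have "a - twos v \<subseteq> b - twos v" using b(2) S_sub by blast
    then have "b - twos v = a - twos v" using max b(1) True by blast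
    \<comment> \<open>Inside \<open>twos v\<close> both edges lie between \<open>S - {x}\<close> and
      \<open>S\<close>, so they differ at most at \<open>x\<close> and are comparable.\<close>
    moreover have "S - {x} \<subseteq> a" "S - {x} \<subseteq> b"
      using a(1) b(1) unfolding S_mins by (auto simp: S_def)
    ultimately have "a \<subseteq> b \<or> b \<subseteq> a" using True a(2) by blast
    then show ?thesis using mins_antichain a(1) b(1) by blast
  next
    case False
    then obtain t where t: "t \<in> b" "t \<in> twos v" "t \<notin> S" by blast
    \<comment> \<open>The rival \<open>b\<close> contains a two \<open>t\<close> outside
      \<open>S\<close>, which still has value 2 while \<open>x\<close> has value 1. Exchanging
      \<open>x\<close> for \<open>t\<close> shows that \<open>b\<close> is too expensive to be
      minimal.\<close>
    have "cost (low v S) a < cost (low v S) b"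
    proof (rule cost_exchange)
      show "low v S \<in> weights"
        using low_in_weights[OF v] S_sub twos_subset by blast
      show "a - {x} \<subseteq> b"
        using b(2) b(1) a(2) unfolding S_mins by (auto simp: S_def)
      show "low v S x < low v S t"
        using t twos_D[OF t(2)] twos_D[OF x] by (simp add: low_def S_def)
    qed (use a b t subsetD[OF twos_subset x] S_sub mins_H in auto)
    then show ?thesis
      using a(1) b(1) by (force simp: mins_def)
  qed
  then have "valid v S a"
    using a S_sub by (auto simp: valid_def S_def)
  then show ?thesis using S_ne by blast
qed

lemma outputs_of_single:
  assumes "v \<in> lifted" "card (twos v) = 1"
  shows "card (outputs v) \<ge> 1"
proof -
  obtain x where x: "twos v = {x}" using assms(2) by (rule card_1_singletonE)
  obtain e where "e \<in> mins (low v {x})" using mins_nonempty by blast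
  from valid_above_single[OF assms(1) x this] have "outputs v \<noteq> {}"
    by (auto simp: outputs_def)
  then show ?thesis
    using finite_outputs[OF assms(1)] by (simp add: Suc_le_eq card_gt_0_iff)
qed

text \<open>Let \<open>e\<close> be a minimum edge of \<open>low v (twos v)\<close> with
  inclusion-minimal trace on \<open>twos v\<close>. If the trace is everything,
  \<open>S = twos v\<close> gives one result, and any other minimum edge there or at some
  \<open>low v {x}\<close> leads to a second; otherwise \<open>v\<close> is bad. If the trace is
  empty, every singleton \<open>S\<close> works with \<open>e\<close>. In between, the trace itself
  gives one result, and the second comes from adding a point outside \<open>e\<close> or from the
  edge that blocks this.\<close>

lemma outputs_of_several:
  assumes v: "v \<in> lifted" and card: "card (twos v) \<ge> 2"
  shows "card (outputs v) \<ge> 2 \<or> (card (outputs v) \<ge> 1 \<and> (\<exists>e. bad v e))"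
proof -
  let ?T = "twos v" and ?X = "mins (low v (twos v))"
  define minimal where "minimal e \<longleftrightarrow> e \<in> ?X \<and> (\<forall>e'\<in>?X. e' \<inter> ?T \<subseteq> e \<inter> ?T \<longrightarrow> e' \<inter> ?T = e \<inter> ?T)"
    for e
  have ex_minimal: "\<exists>e'. minimal e' \<and> e' \<inter> ?T \<subseteq> e \<inter> ?T" if eX: "e \<in> ?X" for e
  proof -
    obtain b where "b \<in> ?X" "b \<inter> ?T \<subseteq> e \<inter> ?T"
      "\<forall>c\<in>?X. c \<inter> ?T \<subseteq> b \<inter> ?T \<longrightarrow> c \<inter> ?T = b \<inter> ?T"
      using minimal_image[OF finite_mins eX, of "\<lambda>a. a \<inter> ?T"] by blast
    then show ?thesis unfolding minimal_def by blast
  qed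
  have valid_min: "valid v (e \<inter> ?T) e" if "minimal e" "e \<inter> ?T \<noteq> {}" for e
    using that by (intro valid_minimal[OF v]) (auto simp: minimal_def)
  obtain e where e: "minimal e"
    using ex_minimal mins_nonempty by blast
  have eX: "e \<in> ?X" using e by (simp add: minimal_def)
  have T_ge: "\<exists>x\<in>?T. \<exists>y\<in>?T. x \<noteq> y"
    using card card_le_Suc0_iff_eq[OF finite_twos, of v] by auto
  show ?thesis
  proof (cases "?T \<subseteq> e")
    case True
    then have val: "valid v ?T e" using valid_min[OF e] T_ge by (auto simp: Int_absorb1)
    then have one: "card (outputs v) \<ge> 1"
      using finite_outputs[OF v] by (auto simp: Suc_le_eq card_gt_0_iff outputs_def)
    show ?thesis
    proof (cases "?X = {e}")
      case False
      then obtain a where a: "a \<in> ?X" "a \<noteq> e" using eX by blast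
      \<comment> \<open>The minimal trace is the whole of \<open>?T\<close>, so every edge of
        \<open>?X\<close> has this trace and is minimal too.\<close>
      have eT: "e \<inter> ?T = ?T" using True by blast
      then have aT: "a \<inter> ?T = ?T" using e a(1) unfolding minimal_def by simp
      then have "minimal a" using e a(1) unfolding minimal_def eT by simp
      then have "valid v ?T a" using valid_min[of a] aT T_ge by force
      then show ?thesis using two_outputs[OF v val] a(2) by blast
    next
      case only: True
      show ?thesis
      proof (cases "\<forall>x\<in>?T. mins (low v {x}) = {e}")
        case True
        with \<open>?T \<subseteq> e\<close> have "bad v e" unfolding bad_def by blast
        then show ?thesis using one by blast
      next
        case False
        then obtain x where "x \<in> ?T" "mins (low v {x}) \<noteq> {e}" by blast
        moreover from this obtain a where "a \<in> mins (low v {x})" "a \<noteq> e"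
          using mins_nonempty[of "low v {x}"] by blast
        ultimately obtain S b where "valid v S b" "S \<noteq> ?T"
          using valid_of_second_min[OF v _ only \<open>?T \<subseteq> e\<close>] by blast
        then show ?thesis using two_outputs[OF v val] by blast
      qed
    qed
  next
    case False
    have val_insert: "valid v (insert x (e \<inter> ?T)) e"
      if "x \<in> ?T" and none: "\<And>a. \<lbrakk>a \<in> ?X; a \<noteq> e; e - insert x (e \<inter> ?T) \<subseteq> a;
        a \<inter> ?T \<subseteq> insert x (e \<inter> ?T)\<rbrakk> \<Longrightarrow> False" for x
    proof -
      have "mins (low v (insert x (e \<inter> ?T))) = {a \<in> ?X. a \<inter> ?T \<subseteq> insert x (e \<inter> ?T)}"
        using that(1) eX by (intro mins_low_part[OF v]) auto
      then show ?thesis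
        using that(1) none eX unfolding valid_def by auto
    qed
    show ?thesis
    proof (cases "e \<inter> ?T = {}")
      case True
      have "valid v {x} e" if "x \<in> ?T" for x
      proof -
        have "a = e" if "a \<in> ?X" "e - insert x (e \<inter> ?T) \<subseteq> a" for a
          using that mins_antichain[OF eX that(1)] True \<open>x \<in> ?T\<close> by blast
        then show ?thesis using val_insert[OF that] True by metis
      qed
      then show ?thesis using T_ge two_outputs[OF v] by blast
    next
      case ne: False
      obtain x where x: "x \<in> ?T" "x \<notin> e" using False by blast
      show ?thesis
      proof (cases "valid v (insert x (e \<inter> ?T)) e")
        case True
        then show ?thesis using two_outputs[OF v valid_min[OF e ne] True] x by blast
      next
        case False
        then obtain a where a: "a \<in> ?X" "a \<noteq> e" "e - insert x (e \<inter> ?T) \<subseteq> a"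
          using val_insert[OF x(1)] by blast
        \<comment> \<open>Since \<open>x\<close> is not in \<open>e\<close>, the blocking edge
          \<open>a\<close> contains \<open>e - ?T\<close>. With the trace of \<open>e\<close> as
          well, it would contain \<open>e\<close>.\<close>
        then have nsub: "\<not> e \<inter> ?T \<subseteq> a \<inter> ?T"
          using mins_antichain[OF eX a(1)] x by blast
        obtain b where b: "minimal b" "b \<inter> ?T \<subseteq> a \<inter> ?T" using ex_minimal[OF a(1)] by blast
        then have "b \<inter> ?T \<noteq> e \<inter> ?T" using nsub by blast
        \<comment> \<open>An empty trace would lie below the nonempty trace of \<open>e\<close>,
          against the minimality of \<open>e\<close>.\<close>
        moreover have "b \<inter> ?T \<noteq> {}"
          using e b(1) ne unfolding minimal_def by (metis empty_subsetI)
        ultimately show ?thesis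
          using two_outputs[OF v valid_min[OF e ne] valid_min[OF b(1)]] by metis
      qed
    qed
  qed
qed

section \<open>Climbing from bad weights\<close>

definition climb :: "(nat \<Rightarrow> nat) \<Rightarrow> nat set \<Rightarrow> nat \<Rightarrow> nat \<Rightarrow> nat \<Rightarrow> nat" where
  "climb b e x k = (\<lambda>i. if i = x then 1 else if i \<in> e then b i + k else b i)"

text \<open>Membership in \<open>weights\<close> is demanded because a climb may exceed
  \<open>M\<close>; this too counts as the end of the climb.\<close>

definition unique_min :: "(nat \<Rightarrow> nat) \<Rightarrow> nat set \<Rightarrow> bool" where
  "unique_min w e \<longleftrightarrow> w \<in> weights \<and> mins w = {e}"

definition top_of :: "(nat \<Rightarrow> nat) \<Rightarrow> nat set \<Rightarrow> nat \<Rightarrow> nat \<Rightarrow> bool" where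
  "top_of b e x k \<longleftrightarrow> bad b e \<and> x \<in> twos b \<and>
     unique_min (climb b e x k) e \<and> \<not> unique_min (climb b e x (Suc k)) e"

definition tops :: "(nat \<Rightarrow> nat) \<Rightarrow> (nat \<Rightarrow> nat) set" where
  "tops b = {climb b e x k | e x k. top_of b e x k}"

lemma other_two:
  assumes "card (twos b) \<ge> 2"
  obtains y where "y \<in> twos b" "y \<noteq> x"
proof -
  have "\<not> twos b \<subseteq> {x}" using assms card_mono[of "{x}" "twos b"] by auto
  then show ?thesis using that by blast
qed

text \<open>The climb starts at \<open>low b {x}\<close>, which isolates \<open>e\<close> because
  \<open>b\<close> is bad. It must end: a second two of \<open>b\<close> lies in \<open>e\<close>
  and would reach \<open>M + 2\<close> after \<open>M\<close> steps.\<close>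

lemma ex_top:
  assumes "b \<in> lifted" "card (twos b) \<ge> 2" "bad b e" "x \<in> twos b"
  shows "\<exists>k. top_of b e x k"
proof (rule ccontr)
  assume "\<not> ?thesis"
  then have step: "unique_min (climb b e x k) e \<Longrightarrow> unique_min (climb b e x (Suc k)) e" for k
    using assms(3,4) by (auto simp: top_of_def)
  have "climb b e x 0 = low b {x}"
    using twos_D[OF assms(4)] by (auto simp: climb_def low_def)
  moreover have "low b {x} \<in> weights"
    using low_in_weights[OF assms(1), of "{x}"] subsetD[OF twos_subset assms(4)] by simp
  ultimately have "unique_min (climb b e x 0) e"
    using assms(3,4) by (simp add: unique_min_def bad_def)
  then have "unique_min (climb b e x k) e" for k
    by (induction k) (simp_all add: step)
  then have "climb b e x M \<in> weights" by (simp add: unique_min_def)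
  moreover obtain y where y: "y \<in> twos b" "y \<noteq> x" using other_two[OF assms(2)] .
  ultimately have "climb b e x M y \<le> M"
    using subsetD[OF twos_subset y(1)] by (auto simp: weights_def PiE_iff)
  moreover have "y \<in> e" using y(1) assms(3) by (auto simp: bad_def)
  ultimately show False using y twos_D[OF y(1)] by (simp add: climb_def)
qed

lemma climb_ones:
  assumes "b \<in> lifted" "i \<in> {1..n}"
  shows "climb b e x k i = 1 \<longleftrightarrow> i = x"
  using lifted_range[OF assms] by (auto simp: climb_def)

lemma tops_subset: "b \<in> lifted \<Longrightarrow> tops b \<subseteq> Z\<^sub>1 n H M f"
proof
  fix w assume b: "b \<in> lifted" and "w \<in> tops b"
  then obtain e x k where w: "w = climb b e x k" and t: "top_of b e x k"
    by (auto simp: tops_def)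
  then have "x \<in> {1..n}" "w \<in> weights" "mins w = {e}"
    using subsetD[OF twos_subset, of x b] by (auto simp: top_of_def unique_min_def)
  then show "w \<in> Z\<^sub>1 n H M f"
    by (intro in_Z1I[of w e x]) (auto simp: w climb_def)
qed

text \<open>The common weight reveals \<open>e\<close> as its only minimum edge and \<open>x\<close>
  as its only place of value 1. Once the heights \<open>k\<close> and \<open>k'\<close> agree,
  \<open>b\<close> and \<open>b'\<close> agree off \<open>x\<close>, and at \<open>x\<close> both
  are 2.\<close>

lemma top_unique:
  assumes "b \<in> lifted" "b' \<in> lifted" "card (twos b) \<ge> 2" "card (twos b') \<ge> 2"
    and t: "top_of b e x k" "top_of b' e' x' k'"
    and eq: "climb b e x k = climb b' e' x' k'"
  shows "b = b' \<and> x = x'"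
proof -
  have e: "e' = e" using t eq by (auto simp: top_of_def unique_min_def)
  have x: "x \<in> twos b" "x' \<in> twos b'" using t by (auto simp: top_of_def)
  then have "x \<in> {1..n}" using twos_subset by blast
  then have xx: "x' = x"
    using climb_ones[OF assms(1), of x e x k] climb_ones[OF assms(2), of x e' x' k'] eq by simp
  \<comment> \<open>At a two \<open>y\<close> of \<open>c'\<close> other than \<open>x\<close>, the
    common value is \<open>2 + l'\<close> and at least \<open>2 + l\<close>. By symmetry this fixes
    the height.\<close>
  have le: "l \<le> l'"
    if c: "c \<in> lifted" "climb c e x l = climb c' e x l'" "twos c' \<subseteq> e" "card (twos c') \<ge> 2"
    for c c' l l'
  proof -
    obtain y where y: "y \<in> twos c'" "y \<noteq> x" using other_two[OF c(4)] .
    then have "y \<in> e" "y \<in> {1..n}" using c(3) twos_subset by blast+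
    then have "c y + l = c' y + l'" using fun_cong[OF c(2), of y] y by (simp add: climb_def)
    moreover have "c y \<ge> 2" using lifted_range[OF c(1) \<open>y \<in> {1..n}\<close>] by simp
    ultimately show ?thesis using twos_D[OF y(1)] by simp
  qed
  have "twos b \<subseteq> e" "twos b' \<subseteq> e"
    using t e by (auto simp: top_of_def bad_def)
  moreover have "climb b e x k = climb b' e x k'" using eq e xx by simp
  ultimately have k: "k = k'"
    using le[OF assms(1) _ _ assms(4)] le[OF assms(2) _ _ assms(3)] by (metis antisym)
  have "b i = b' i" for i
    using fun_cong[OF eq, of i] twos_D[OF x(1)] twos_D[OF x(2)] unfolding e xx k
    by (cases "i = x") (auto simp: climb_def split: if_splits)
  then show ?thesis using xx by blast
qed

lemma tops_disjoint:
  assumes "b \<in> lifted" "b' \<in> lifted" "card (twos b) \<ge> 2" "card (twos b') \<ge> 2" "b \<noteq> b'"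
  shows "tops b \<inter> tops b' = {}"
proof (rule ccontr)
  assume "tops b \<inter> tops b' \<noteq> {}"
  then obtain e x k e' x' k' where "top_of b e x k" "top_of b' e' x' k'"
    "climb b e x k = climb b' e' x' k'"
    unfolding tops_def by blast
  then show False using top_unique[OF assms(1-4)] assms(5) by blast
qed

lemma finite_tops: "b \<in> lifted \<Longrightarrow> finite (tops b)"
  using tops_subset finite_Z1 finite_subset by blast

lemma two_tops:
  assumes "b \<in> lifted" "card (twos b) \<ge> 2" "bad b e"
  shows "card (tops b) \<ge> 2"
proof -
  obtain x where x: "x \<in> twos b" using other_two[OF assms(2)] .
  obtain y where y: "y \<in> twos b" "y \<noteq> x" using other_two[OF assms(2)] .
  obtain k where k: "top_of b e x k" using ex_top[OF assms x] ..
  obtain l where l: "top_of b e y l" using ex_top[OF assms y(1)] ..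
  show ?thesis
  proof (rule card_ge_2)
    show "climb b e x k \<in> tops b" "climb b e y l \<in> tops b"
      using k l by (auto simp: tops_def)
    show "climb b e x k \<noteq> climb b e y l"
      using top_unique[OF assms(1,1,2,2) k l] y(2) by blast
  qed (rule finite_tops[OF assms(1)])
qed

text \<open>Comparing ones gives \<open>S = {x}\<close>, so off \<open>x\<close> the weight
  \<open>v\<close> is \<open>b\<close> raised by \<open>k + 1\<close> on \<open>e\<close>. All twos
  of \<open>b\<close> lie in \<open>e\<close>, which leaves \<open>x\<close> as the only two of
  \<open>v\<close>. Moreover \<open>low v {x}\<close> is the next step of the climb, where
  \<open>e\<close> is no longer isolated, and this tie supplies a second result.\<close>

lemma output_is_top:
  assumes b: "b \<in> lifted" and v: "v \<in> lifted" and w: "w \<in> tops b" "w \<in> outputs v"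
  shows "card (twos v) = 1 \<and> card (outputs v) \<ge> 2"
proof -
  obtain e x k where wb: "w = climb b e x k" and t: "top_of b e x k"
    using w(1) by (auto simp: tops_def)
  obtain S e' where wv: "w = low v (S \<union> e')" and val: "valid v S e'"
    using w(2) by (auto simp: outputs_def)
  have e': "e' = e"
    using t valid_mins[OF v val] wb wv by (auto simp: top_of_def unique_min_def)
  have x: "x \<in> twos b" and T: "twos b \<subseteq> e"
    using t by (auto simp: top_of_def bad_def)
  have xn: "x \<in> {1..n}" using subsetD[OF twos_subset x] .
  have S: "S = {x}"
  proof (rule set_eqI)
    fix i
    show "i \<in> S \<longleftrightarrow> i \<in> {x}"
      using valid_ones[OF v val, of i] climb_ones[OF b, of i e x k] valid_subset(1)[OF val]
        wb wv xn by (cases "i \<in> {1..n}") auto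
  qed
  have vx: "v x = 2" using val S by (auto simp: valid_def twos_def)
  have v_eq: "v i = (if i \<in> e then b i + k + 1 else b i)" if "i \<noteq> x" "i \<in> {1..n}" for i
  proof -
    have "w i = (if i \<in> e then b i + k else b i)" using that by (simp add: wb climb_def)
    moreover have "w i = (if i \<in> e then v i - 1 else v i)" using that by (simp add: wv low_def S e')
    ultimately show ?thesis using lifted_range[OF v that(2)] by (auto split: if_splits)
  qed
  have "v i \<noteq> 2" if "i \<noteq> x" "i \<in> {1..n}" for i
    using v_eq[OF that] lifted_range[OF b that(2)] T that(2) by (auto simp: twos_def)
  then have tv: "twos v = {x}" using vx xn by (auto simp: twos_def)
  have out: "b i = v i" if "i \<notin> {1..n}" for i
    using b v that by (auto simp: lifted_def PiE_iff extensional_def)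
  have "e \<subseteq> {1..n}" using valid_subset(2)[OF val] e' by simp
  then have up: "climb b e x (Suc k) = low v {x}"
    using v_eq vx out by (fastforce simp: climb_def low_def)
  \<comment> \<open>As no value exceeds \<open>M\<close>, the climb can only have failed here
    through a second minimum edge.\<close>
  have "low v {x} \<in> weights" using low_in_weights[OF v, of "{x}"] xn by simp
  then have "mins (low v {x}) \<noteq> {e}"
    using t up by (simp add: top_of_def unique_min_def)
  then obtain a where a: "a \<in> mins (low v {x})" "a \<noteq> e"
    using mins_nonempty[of "low v {x}"] by blast
  obtain a' where a': "valid v {x} a'" "a - {x} \<subseteq> a'"
    using valid_above_single[OF v tv a(1)] by blast
  have "x \<in> e" using x T by blast
  moreover have "e \<in> mins (low v {x})" using val by (simp add: valid_def S e')
  \<comment> \<open>If \<open>a'\<close> were \<open>e\<close>, then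
    \<open>a - {x} \<subseteq> e\<close> and \<open>x \<in> e\<close> would give
    \<open>a \<subseteq> e\<close>.\<close>
  ultimately have "a' \<noteq> e" using a a'(2) mins_antichain[OF a(1)] by blast
  then show ?thesis
    using two_outputs[OF v a'(1) val] tv e' by simp
qed

section \<open>Counting results and tops together\<close>

definition single :: "(nat \<Rightarrow> nat) set" where
  "single = {v \<in> lifted. card (twos v) = 1}"

definition several :: "(nat \<Rightarrow> nat) set" where
  "several = {v \<in> lifted. card (twos v) \<ge> 2}"

lemma card_Z1_ge: "card single + 2 * card several \<le> card (Z\<^sub>1 n H M f)"
proof -
  let ?Z = "Z\<^sub>1 n H M f"
  define B where "B = {v \<in> several. \<exists>e. bad v e}"
  define Q where "Q = (\<Union>b\<in>B. tops b)"
  define R where "R = (\<Union>v\<in>single \<union> several. outputs v)"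
  have fin: "finite single" "finite several" "finite B"
    using finite_lifted by (auto simp: single_def several_def B_def)
  have lifted: "v \<in> lifted" if "v \<in> single \<union> several" for v
    using that by (auto simp: single_def several_def)
  have disj: "single \<inter> several = {}" by (auto simp: single_def several_def)
  have B_sub: "B \<subseteq> several" by (auto simp: B_def)
  have B_D: "b \<in> lifted" "card (twos b) \<ge> 2" if "b \<in> B" for b
    using that by (auto simp: B_def several_def)
  have sub: "Q \<subseteq> ?Z" "R \<subseteq> ?Z"
    using tops_subset[OF B_D(1)] outputs_subset[OF lifted] by (auto simp: Q_def R_def)
  then have finQR: "finite Q" "finite R" using finite_Z1 finite_subset by blast+
  have "card Q = (\<Sum>b\<in>B. card (tops b))"
    unfolding Q_def using fin(3) finite_tops[OF B_D(1)] tops_disjoint[OF B_D(1) B_D(1) B_D(2) B_D(2)]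
    by (intro card_UN_disjoint) simp_all
  also have "\<dots> \<ge> (\<Sum>b\<in>B. 2)"
    using two_tops by (intro sum_mono) (auto simp: B_def several_def)
  finally have Q: "card Q \<ge> 2 * card B" by simp
  have "card R = (\<Sum>v\<in>single \<union> several. card (outputs v))"
    unfolding R_def using fin finite_outputs[OF lifted] outputs_disjoint[OF lifted lifted]
    by (intro card_UN_disjoint) simp_all
  also have "\<dots> = (\<Sum>v\<in>single. card (outputs v)) + (\<Sum>v\<in>several. card (outputs v))"
    by (rule sum.union_disjoint[OF fin(1,2) disj])
  finally have R: "card R = \<dots>" .
  \<comment> \<open>All counts are doubled. A bad weight may yield only one result; its extra 2 is
    paid for by its two tops, each worth one half.\<close>
  have "(\<Sum>v\<in>several. 4) \<le> (\<Sum>v\<in>several. 2 * card (outputs v) + (if v \<in> B then 2 else 0))"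
  proof (rule sum_mono)
    fix v assume "v \<in> several"
    then show "4 \<le> 2 * card (outputs v) + (if v \<in> B then 2 else 0)"
      using outputs_of_several[of v] by (auto simp: several_def B_def)
  qed
  also have "\<dots> = 2 * (\<Sum>v\<in>several. card (outputs v)) + 2 * card B"
    using fin B_sub by (simp add: sum.distrib sum_distrib_left sum.If_cases Int_absorb1)
  finally have sev: "4 * card several \<le> 2 * (\<Sum>v\<in>several. card (outputs v)) + 2 * card B"
    by simp
  \<comment> \<open>If some result of \<open>v\<close> is a top, \<open>v\<close> has at least two
    results, and twice their number covers both the required 2 and all its results in
    \<open>Q\<close>.\<close>
  have sing: "2 + card (Q \<inter> outputs v) \<le> 2 * card (outputs v)" if "v \<in> single" for v
  proof (cases "Q \<inter> outputs v = {}")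
    case True
    then show ?thesis using outputs_of_single that by (auto simp: single_def)
  next
    case False
    then have "card (outputs v) \<ge> 2"
      using output_is_top[OF B_D(1) lifted] that by (auto simp: Q_def)
    moreover have "card (Q \<inter> outputs v) \<le> card (outputs v)"
      using finite_outputs[OF lifted] that by (intro card_mono) auto
    ultimately show ?thesis by linarith
  qed
  have "Q \<inter> R \<subseteq> (\<Union>v\<in>single. Q \<inter> outputs v)"
  proof
    fix w assume "w \<in> Q \<inter> R"
    then obtain b v where bv: "b \<in> B" "w \<in> tops b" "v \<in> single \<union> several" "w \<in> outputs v"
      and "w \<in> Q"
      unfolding Q_def R_def by blast
    have "card (twos v) = 1"
      using output_is_top[OF B_D(1)[OF bv(1)] lifted[OF bv(3)] bv(2,4)] by blast
    then have "v \<in> single" using lifted[OF bv(3)] by (simp add: single_def)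
    then show "w \<in> (\<Union>v\<in>single. Q \<inter> outputs v)" using \<open>w \<in> Q\<close> bv(4) by blast
  qed
  then have "card (Q \<inter> R) \<le> card (\<Union>v\<in>single. Q \<inter> outputs v)"
    using fin finQR by (intro card_mono) auto
  also have "\<dots> \<le> (\<Sum>v\<in>single. card (Q \<inter> outputs v))"
    using fin(1) by (rule card_UN_le)
  finally have QR: "card (Q \<inter> R) \<le> \<dots>" .
  have "2 * card single + (\<Sum>v\<in>single. card (Q \<inter> outputs v)) = (\<Sum>v\<in>single. 2 + card (Q \<inter> outputs v))"
    by (simp only: sum.distrib sum_constant of_nat_id mult.commute)
  also have "\<dots> \<le> (\<Sum>v\<in>single. 2 * card (outputs v))"
    by (intro sum_mono sing)
  also have "\<dots> = 2 * (\<Sum>v\<in>single. card (outputs v))"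
    by (simp add: sum_distrib_left)
  finally have sin: "2 * card single + (\<Sum>v\<in>single. card (Q \<inter> outputs v)) \<le> \<dots>" .
  \<comment> \<open>Only half of the tops outside \<open>R\<close> is needed:
    \<open>2 * card ?Z\<close> is at least \<open>2 * card R + card Q - card (Q \<inter> R)\<close>,
    and the surplus in \<open>sin\<close> absorbs the subtracted overlap.\<close>
  have "card (Q \<union> R) \<le> card ?Z"
    using sub finite_Z1 by (intro card_mono) auto
  moreover have "card (Q \<union> R) + card (Q \<inter> R) = card Q + card R"
    using card_Un_Int[OF finQR] by simp
  moreover have "card (Q \<inter> R) \<le> card Q"
    using finQR by (intro card_mono) auto
  ultimately show ?thesis using Q R sev sin QR by linarith
qed

section \<open>Cardinalities of the classes of lifted weights\<close>

lemma card_lifted: "card lifted = (M - 1) ^ n"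
  by (simp add: lifted_def card_PiE)

lemma card_no_twos: "card {v \<in> lifted. twos v = {}} = (M - 2) ^ n"
proof -
  have "{v \<in> lifted. twos v = {}} = {1..n} \<rightarrow>\<^sub>E {3..M}"
  proof (rule set_eqI)
    fix v
    have "(\<forall>i\<in>{1..n}. v i \<in> {2..M}) \<and> (\<forall>i\<in>{1..n}. v i \<noteq> 2) \<longleftrightarrow>
        (\<forall>i\<in>{1..n}. v i \<in> {3..M})"
      by force
    then show "v \<in> {v \<in> lifted. twos v = {}} \<longleftrightarrow> v \<in> {1..n} \<rightarrow>\<^sub>E {3..M}"
      by (auto simp: lifted_def twos_def PiE_iff)
  qed
  then show ?thesis by (simp add: card_PiE)
qed

lemma card_twos_eq_single:
  assumes "x \<in> {1..n}" "M \<ge> 2"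
  shows "card {v \<in> lifted. twos v = {x}} = (M - 2) ^ (n - 1)"
proof -
  let ?F = "\<lambda>i. if i = x then {2} else {3..M}"
  have "v \<in> lifted \<and> twos v = {x} \<longleftrightarrow> v \<in> Pi\<^sub>E {1..n} ?F" for v
  proof
    assume *: "v \<in> lifted \<and> twos v = {x}"
    then have "v i \<in> ?F i" if "i \<in> {1..n}" for i
      using lifted_range[of v i] that by (cases "i = x") (force simp: twos_def)+
    then show "v \<in> Pi\<^sub>E {1..n} ?F" using * by (simp add: lifted_def PiE_iff)
  next
    assume *: "v \<in> Pi\<^sub>E {1..n} ?F"
    then have F: "v i \<in> ?F i" if "i \<in> {1..n}" for i using that by (auto simp: PiE_iff)
    then have "v i \<in> {2..M} \<and> (v i = 2 \<longleftrightarrow> i = x)" if "i \<in> {1..n}" for i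
      using F[OF that] assms(2) by (cases "i = x") auto
    then show "v \<in> lifted \<and> twos v = {x}"
      using * assms(1) by (auto simp: lifted_def PiE_iff twos_def)
  qed
  then have "{v \<in> lifted. twos v = {x}} = Pi\<^sub>E {1..n} ?F" by blast
  then have "card {v \<in> lifted. twos v = {x}} = (\<Prod>i\<in>{1..n}. card (?F i))"
    by (simp add: card_PiE)
  also have "\<dots> = card (?F x) * (\<Prod>i\<in>{1..n} - {x}. card (?F i))"
    using assms(1) by (intro prod.remove) auto
  also have "(\<Prod>i\<in>{1..n} - {x}. card (?F i)) = (\<Prod>i\<in>{1..n} - {x}. M - 2)"
    by (rule prod.cong) auto
  finally show ?thesis using assms(1) by simp
qed

lemma card_single:
  assumes "M \<ge> 2"
  shows "card single = n * (M - 2) ^ (n - 1)"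
proof -
  have "single = (\<Union>x\<in>{1..n}. {v \<in> lifted. twos v = {x}})"
    using twos_subset by (auto simp: single_def card_1_singleton_iff)
  then have "card single = (\<Sum>x\<in>{1..n}. card {v \<in> lifted. twos v = {x}})"
    using finite_lifted by (simp only:) (intro card_UN_disjoint, auto)
  then show ?thesis using card_twos_eq_single[OF _ assms] by simp
qed

text \<open>Lifted weights have no two, one two or several, so
  \<open>card single + 2 * card several\<close> equals twice \<open>card lifted\<close>, minus twice
  the number without twos, minus \<open>card single\<close>.\<close>

lemma card_Z1_bound:
  assumes "M \<ge> 2"
  shows "int (card (Z\<^sub>1 n H M f)) \<ge>
    2 * (int M - 1) ^ n - 2 * (int M - 2) ^ n - int n * (int M - 2) ^ (n - 1)"
proof -
  have "lifted = {v \<in> lifted. twos v = {}} \<union> (single \<union> several)"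
  proof -
    have "twos v = {} \<or> card (twos v) = 1 \<or> card (twos v) \<ge> 2" for v
      using finite_twos[of v] card_0_eq[of "twos v"] by linarith
    then show ?thesis by (auto simp: single_def several_def)
  qed
  then have "card lifted = card ({v \<in> lifted. twos v = {}} \<union> (single \<union> several))" by simp
  also have "\<dots> = card {v \<in> lifted. twos v = {}} + card (single \<union> several)"
    using finite_lifted by (intro card_Un_disjoint) (auto simp: single_def several_def)
  also have "card (single \<union> several) = card single + card several"
    using finite_lifted by (intro card_Un_disjoint) (auto simp: single_def several_def)
  finally have "(M - 1) ^ n = (M - 2) ^ n + (n * (M - 2) ^ (n - 1) + card several)"
    by (simp only: card_lifted card_no_twos card_single[OF assms])
  then have "int ((M - 1) ^ n) = int ((M - 2) ^ n + (n * (M - 2) ^ (n - 1) + card several))"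
    by (simp only:)
  \<comment> \<open>Truncated subtraction agrees with integer subtraction because
    \<open>M \<ge> 2\<close>.\<close>
  then have "(int M - 1) ^ n = (int M - 2) ^ n + int n * (int M - 2) ^ (n - 1) + int (card several)"
    using assms by (simp add: of_nat_diff)
  moreover have "int (card single) = int n * (int M - 2) ^ (n - 1)"
    using assms by (simp add: card_single of_nat_diff)
  moreover have "int (card single + 2 * card several) \<le> int (card (Z\<^sub>1 n H M f))"
    using card_Z1_ge by (simp only: of_nat_le_iff)
  ultimately show ?thesis by simp
qed

end

section \<open>The edgeless hypergraph and the final bound\<close>

lemma isolating_empty_edge: "isolating {{}} f w"
  by (auto simp: isolating_def is_arg_min_def)

theorem theorem1:
  fixes M n :: nat
  assumes "M \<ge> 2" and "n \<ge> 1"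
  shows "int (Y\<^sub>1 M n) \<ge>
    2 * (int M - 1) ^ n - 2 * (int M - 2) ^ n - int n * (int M - 2) ^ (n - 1)"
proof -
  have "Y\<^sub>1 M n \<in> {card (Z\<^sub>1 n H M f) | H f. hypergraph n H \<and> admissible M f}"
    unfolding Y\<^sub>1_def by (rule Min_in[OF finite_Y\<^sub>1_set nonempty_Y\<^sub>1_set])
  then obtain H f where Y: "Y\<^sub>1 M n = card (Z\<^sub>1 n H M f)" and H: "hypergraph n H" "admissible M f"
    by blast
  \<comment> \<open>The edgeless hypergraph isolates the same weights as the one whose only edge is empty.\<close>
  define H' where "H' = (if H = {} then {{}} else H)"
  have "isolation n M H' f"
    using H by (auto simp: H'_def isolation_def hypergraph_def)
  moreover have "Z\<^sub>1 n H' M f = Z\<^sub>1 n H M f"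
    by (auto simp: H'_def Z\<^sub>1_def isolating_empty_edge) (auto simp: isolating_def)
  ultimately show ?thesis
    using isolation.card_Z1_bound[of n M H' f] assms(1) Y by simp
qed

end
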